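(* There exist infinitely many natural numbers $n$ which cannot be written as $n = z + x^2$ with $z$ a Zumkeller number and $x$ a positive integer.
   Context: A natural number $n$ is a Zumkeller number if the set of its positive divisors can be partitioned into two subsets with equal sums. Here "a square" means the square of a positive integer. *)

theory Defs
  imports Main
begin

(* The condition n > 0 is needed: every number divides 0, and a sum over an infinite set is 0. *)
definition zumkeller :: "nat \<Rightarrow> bool" where
  "zumkeller n \<longleftrightarrow> n > 0 \<and>
     (\<exists>A B. A \<union> B = {d. d dvd n} \<and> A \<inter> B = {} \<and> \<Sum>A = \<Sum>B)"

end

theory Submission
  imports Defs "HOL-Analysis.Infinite_Products" "HOL-Number_Theory.Number_Theory"
begin

text \<open>
  A Zumkeller number is not deficient, so it suffices to make every \<open>n - x\<^sup>2\<close> deficient. Let \<open>P\<close> be the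
  set of odd primes below \<open>N\<close> and choose \<open>n\<close> with \<open>n \<equiv> 2\<close> modulo 4 and \<open>n\<close> a quadratic nonresidue
  modulo every \<open>p \<in> P\<close>. Then \<open>n - x\<^sup>2\<close> is \<open>m\<close> or \<open>2m\<close>, where \<open>m\<close> is odd with all prime factors at
  least \<open>N\<close>. By the Chinese remainder theorem \<open>n\<close> can be taken below \<open>4 (N + 1) \<Prod>P\<close>, which is so
  small that \<open>m\<close> has at most \<open>|P| + 1\<close> distinct prime factors. For \<open>N\<close> a multiple of 210, sieving by
  2, 3, 5 and 7 gives \<open>|P| + 1 < N / 4\<close>, hence \<open>\<Prod> (1 - 1/q) > 3/4\<close> over the primes \<open>q\<close> dividing \<open>m\<close>.
  So \<open>\<sigma>(m) < 4m/3\<close> and \<open>\<sigma>(2m) < 4m\<close>.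
\<close>

section \<open>Divisor sums and deficiency\<close>

definition divisor_sum :: "nat \<Rightarrow> nat" where
  "divisor_sum n = \<Sum>{d. d dvd n}"

lemma divisor_sum_ge:
  assumes "n > 0"
  shows "n \<le> divisor_sum n"
  unfolding divisor_sum_def using assms by (intro member_le_sum) auto

text \<open>The half that contains \<open>n\<close> itself has sum at least \<open>n\<close>, hence
  so does the other half.\<close>

lemma zumkeller_imp_not_deficient:
  assumes "zumkeller n"
  shows "2 * n \<le> divisor_sum n"
proof -
  from assms obtain A B where n: "n > 0" and AB: "A \<union> B = {d. d dvd n}" "A \<inter> B = {}" "\<Sum>A = \<Sum>B"
    unfolding zumkeller_def by blast
  have "finite (A \<union> B)"
    using n AB(1) by simp
  then have fin: "finite A" "finite B" by auto
  have "n \<in> A \<or> n \<in> B"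
    using AB(1) by auto
  then have "n \<le> \<Sum>A"
    using AB(3) fin member_le_sum[of n A "\<lambda>x. x"] member_le_sum[of n B "\<lambda>x. x"] by auto
  moreover have "divisor_sum n = \<Sum>A + \<Sum>B"
    unfolding divisor_sum_def AB(1)[symmetric] using sum.union_disjoint[OF fin AB(2)] by simp
  ultimately show ?thesis
    using AB(3) by simp
qed

text \<open>Every divisor of \<open>a * b\<close> is a divisor of \<open>a\<close> times a divisor
  of \<open>b\<close>, possibly in several ways. The upper bound is all that is needed later, and it
  requires no coprimality.\<close>

lemma divisor_sum_mult_le:
  assumes "a > 0" "b > 0"
  shows "divisor_sum (a * b) \<le> divisor_sum a * divisor_sum b"
proof -
  let ?D = "{d. d dvd a} \<times> {d. d dvd b}"
  have fin: "finite ?D"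
    using assms by simp
  have "divisor_sum (a * b) \<le> \<Sum>((\<lambda>(x, y). x * y) ` ?D)"
    unfolding divisor_sum_def
  proof (rule sum_mono2)
    show "{d. d dvd a * b} \<subseteq> (\<lambda>(x, y). x * y) ` ?D"
    proof
      fix d assume "d \<in> {d. d dvd a * b}"
      then obtain x y where "d = x * y" "x dvd a" "y dvd b"
        using division_decomp[of d a b] by blast
      then show "d \<in> (\<lambda>(x, y). x * y) ` ?D"
        by (intro image_eqI[of _ _ "(x, y)"]) auto
    qed
  qed (use fin in auto)
  also have "\<dots> \<le> (\<Sum>(x, y)\<in>?D. x * y)"
    using sum_image_le[OF fin, of "\<lambda>x. x" "\<lambda>(x, y). x * y"] by (simp add: case_prod_unfold comp_def)
  also have "\<dots> = divisor_sum a * divisor_sum b"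
    unfolding divisor_sum_def by (simp add: sum_product sum.cartesian_product)
  finally show ?thesis .
qed

text \<open>Geometric series: \<open>(p - 1) * \<sigma>(p^k) = p^(k+1) - 1\<close>, and dropping the
  \<open>- 1\<close> leaves a bound independent of \<open>k\<close>.\<close>

lemma divisor_sum_prime_power:
  assumes "prime p"
  shows "(1 - 1 / real p) * real (divisor_sum (p ^ k)) \<le> real (p ^ k)"
proof -
  have p: "p > 1"
    using assms prime_gt_1_nat by blast
  have "{d. d dvd p ^ k} = (\<lambda>i. p ^ i) ` {..k}"
    using divides_primepow_nat[OF assms] by auto
  moreover have "inj_on (\<lambda>i. p ^ i) {..k}"
    using p by (auto simp: inj_on_def)
  ultimately have ds: "real (divisor_sum (p ^ k)) = (\<Sum>i\<le>k. real p ^ i)"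
    by (simp add: divisor_sum_def sum.reindex)
  have "(1 - real p) * (\<Sum>i\<le>k. real p ^ i) = 1 - real p ^ Suc k"
    by (simp add: sum_gp_basic)
  then have "(real p - 1) * (\<Sum>i\<le>k. real p ^ i) \<le> real p * real p ^ k"
    by (simp add: algebra_simps)
  then show ?thesis
    unfolding ds using p by (simp add: field_simps)
qed

lemma divisor_sum_prime_factors:
  assumes "n > 0"
  shows "(\<Prod>p\<in>prime_factors n. 1 - 1 / real p) * real (divisor_sum n) \<le> real n"
proof -
  \<comment> \<open>A set of primes with arbitrary exponents \<open>f\<close> allows induction that
    splits off one prime power at a time.\<close>
  have gen: "(\<Prod>p\<in>S. 1 - 1 / real p) * real (divisor_sum (\<Prod>p\<in>S. p ^ f p)) \<le> real (\<Prod>p\<in>S. p ^ f p)"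
    if "finite S" "\<forall>p\<in>S. prime p" for S :: "nat set" and f
    using that
  proof (induction S rule: finite_induct)
    case empty
    then show ?case by (simp add: divisor_sum_def)
  next
    case (insert q S)
    let ?m = "\<Prod>p\<in>S. p ^ f p"
    have q: "q > 1" "prime q"
      using insert.prems prime_gt_1_nat by auto
    have m: "?m > 0"
      using insert.prems by (intro prod_pos) (auto intro: prime_gt_0_nat)
    have nonneg: "0 \<le> (\<Prod>p\<in>S. 1 - 1 / real p)"
      using insert.prems prime_ge_1_nat by (intro prod_nonneg) (auto simp: divide_le_eq)
    have "(\<Prod>p\<in>insert q S. 1 - 1 / real p) * real (divisor_sum (q ^ f q * ?m))
        \<le> (\<Prod>p\<in>insert q S. 1 - 1 / real p) * (real (divisor_sum (q ^ f q)) * real (divisor_sum ?m))"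
      using divisor_sum_mult_le[of "q ^ f q" ?m] q m nonneg insert.hyps
      by (intro mult_left_mono) (auto simp flip: of_nat_mult simp del: of_nat_prod)
    also have "\<dots> = ((1 - 1 / real q) * real (divisor_sum (q ^ f q)))
        * ((\<Prod>p\<in>S. 1 - 1 / real p) * real (divisor_sum ?m))"
      using insert.hyps by (simp add: mult_ac)
    also have "\<dots> \<le> real (q ^ f q) * real ?m"
      using insert divisor_sum_prime_power[OF q(2)] nonneg by (intro mult_mono) auto
    finally show ?case
      using insert.hyps by simp
  qed
  have "(\<Prod>p\<in>prime_factors n. p ^ multiplicity p n) = n"
    using prod_prime_factors[of n] assms by simp
  then show ?thesis
    using gen[of "prime_factors n" "\<lambda>p. multiplicity p n"] by auto
qed

text \<open>By the Weierstrass inequality the product of the \<open>1 - 1/q\<close> is at least 1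
  minus the sum of the \<open>1/q\<close>, and that sum is at most the number of primes divided by
  \<open>N\<close>.\<close>

lemma divisor_sum_few_large_primes:
  assumes "m > 0" and large: "\<And>p. p \<in> prime_factors m \<Longrightarrow> N \<le> p"
    and few: "4 * card (prime_factors m) < N"
  shows "3 * divisor_sum m < 4 * m"
proof -
  let ?Q = "prime_factors m"
  have N: "N > 0"
    using few by simp
  have "(\<Sum>q\<in>?Q. 1 / real q) \<le> (\<Sum>q\<in>?Q. 1 / real N)"
    using large N by (intro sum_mono divide_left_mono) (auto intro!: mult_pos_pos prime_gt_0_nat)
  also have "\<dots> < 1 / 4"
    using few N by (simp add: field_simps)
  finally have "3 / 4 < 1 - (\<Sum>q\<in>?Q. 1 / real q)"
    by simp
  also have "\<dots> \<le> (\<Prod>q\<in>?Q. 1 - 1 / real q)"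
    by (intro Weierstrass_prod_ineq) (auto simp: divide_le_eq dest: prime_ge_1_nat)
  finally have "3 / 4 * real (divisor_sum m) < (\<Prod>q\<in>?Q. 1 - 1 / real q) * real (divisor_sum m)"
    using divisor_sum_ge[OF assms(1)] assms(1) by simp
  also have "\<dots> \<le> real m"
    by (rule divisor_sum_prime_factors[OF assms(1)])
  finally show ?thesis
    by linarith
qed

section \<open>Nonresidues, a prime count and a bound on the number of large prime factors\<close>

lemma ex_quadratic_nonresidue:
  fixes p :: nat
  assumes "prime p" "p \<noteq> 2"
  shows "\<exists>a. \<forall>x. \<not> [x\<^sup>2 = a] (mod p)"
proof (rule ccontr)
  assume "\<not> ?thesis"
  then have ex: "\<exists>x. [x\<^sup>2 = a] (mod p)" for a by blast
  have p: "p > 2"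
    using assms prime_ge_2_nat[of p] by simp
  let ?f = "\<lambda>x. x\<^sup>2 mod p"
  \<comment> \<open>A surjective self-map of a finite set is injective, but squaring sends 1 and
    \<open>p - 1\<close> to the same residue.\<close>
  have "{..<p} \<subseteq> ?f ` {..<p}"
  proof
    fix a assume a: "a \<in> {..<p}"
    obtain x where "[x\<^sup>2 = a] (mod p)"
      using ex by blast
    then have "a = ?f (x mod p)"
      using a by (simp add: cong_def power_mod)
    then show "a \<in> ?f ` {..<p}"
      using p by auto
  qed
  then have "inj_on ?f {..<p}"
    by (simp add: finite_surj_inj)
  moreover have "?f (p - 1) = ?f 1"
  proof -
    obtain k where "p = k + 2"
      using p by (metis less_imp_add_positive add.commute)
    then have "(p - 1)\<^sup>2 = 1 + k * p"
      by (simp add: power2_eq_square algebra_simps)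
    then show ?thesis
      by (simp del: One_nat_def)
  qed
  ultimately have "p - 1 = 1"
    using p by (elim inj_onD) auto
  then show False
    using p by simp
qed

text \<open>Each of the \<open>T\<close> blocks of length 210 = 2 * 3 * 5 * 7 contains 48 =
  \<open>totient 210\<close> numbers coprime to 210; the extra 3 accounts for the primes 3, 5 and
  7.\<close>

lemma card_primes_below_multiple_of_210:
  "card {p. prime p \<and> p \<noteq> 2 \<and> p < 210 * T} \<le> 48 * T + 3"
proof -
  define R :: "nat set" where "R = totatives 210"
  have "totient 35 = 24"
    using totient_mult_coprime[of 5 7] by (simp add: prime_imp_coprime totient_prime)
  then have "totient 105 = 48"
    using totient_mult_coprime[of 3 35] by (simp add: prime_imp_coprime totient_prime)
  then have "totient 210 = 48"
    using totient_mult_coprime[of 2 105] by (simp add: prime_imp_coprime totient_prime)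
  then have cR: "card R = 48"
    by (simp only: R_def totient_def)
  let ?f = "\<lambda>(r, j). r + 210 * j"
  have "{p. prime p \<and> p \<noteq> 2 \<and> p < 210 * T} \<subseteq> {3, 5, 7} \<union> ?f ` (R \<times> {..<T})"
  proof
    fix p assume "p \<in> {p. prime p \<and> p \<noteq> 2 \<and> p < 210 * T}"
    then have p: "prime p" "p \<noteq> 2" "p < 210 * T" by auto
    show "p \<in> {3, 5, 7} \<union> ?f ` (R \<times> {..<T})"
    proof (cases "p \<in> {3, 5, 7}")
      case False
      have "\<not> p dvd 210"
      proof
        assume "p dvd 210"
        then have "p dvd 2 * (3 * (5 * 7))" by simp
        then have "p dvd 2 \<or> p dvd 3 \<or> p dvd 5 \<or> p dvd 7"
          using p(1) by (simp only: prime_dvd_mult_iff)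
        then have "p = 2 \<or> p = 3 \<or> p = 5 \<or> p = 7"
          using primes_dvd_imp_eq[OF p(1)] by auto
        then show False
          using p(2) False by simp
      qed
      then have "coprime p 210"
        using p(1) by (simp add: prime_imp_coprime)
      then have "coprime (p mod 210) 210"
        by simp
      then have "p mod 210 \<in> R"
        by (auto simp: R_def totatives_def intro!: Nat.gr0I)
      moreover have "p div 210 < T"
        using p(3) by (simp add: div_less_iff_less_mult mult.commute)
      ultimately have "?f (p mod 210, p div 210) \<in> ?f ` (R \<times> {..<T})"
        by (intro imageI) auto
      then show ?thesis by simp
    qed auto
  qed
  moreover have fR: "finite R"
    unfolding R_def by simp
  ultimately have "card {p. prime p \<and> p \<noteq> 2 \<and> p < 210 * T} \<le> card ({3, 5, 7} \<union> ?f ` (R \<times> {..<T}))"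
    by (intro card_mono) auto
  also have "\<dots> \<le> card {3, 5, 7 :: nat} + card (?f ` (R \<times> {..<T}))"
    by (rule card_Un_le)
  also have "\<dots> \<le> 3 + card (R \<times> {..<T})"
    using card_image_le[of "R \<times> {..<T}" ?f] fR by simp
  also have "\<dots> = 48 * T + 3"
    using cR by (simp add: card_cartesian_product)
  finally show ?thesis .
qed

lemma ex_nonresidue_mod_primes:
  fixes P :: "nat set"
  assumes "finite P" "\<And>p. p \<in> P \<Longrightarrow> prime p \<and> p \<noteq> 2"
  shows "\<exists>n < 4 * \<Prod>P. [n = 2] (mod 4) \<and> (\<forall>p\<in>P. \<forall>x. \<not> [x\<^sup>2 = n] (mod p))"
proof -
  \<comment> \<open>The index 2, which is not in \<open>P\<close>, carries the residue 2 and the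
    modulus 4, so that one family serves the Chinese remainder theorem.\<close>
  define a where "a p = (if p = 2 then 2 else SOME a. \<forall>x. \<not> [x\<^sup>2 = a] (mod p))" for p :: nat
  define m where "m p = (if p = 2 then 4 else p)" for p :: nat
  have a: "\<not> [x\<^sup>2 = a p] (mod p)" if "p \<in> P" for p x
    using someI_ex[OF ex_quadratic_nonresidue] assms(2)[OF that] by (auto simp: a_def)
  have cop: "\<forall>i\<in>insert 2 P. \<forall>j\<in>insert 2 P. i \<noteq> j \<longrightarrow> coprime (m i) (m j)"
  proof (intro ballI impI)
    fix i j assume ij: "i \<in> insert 2 P" "j \<in> insert 2 P" "i \<noteq> j"
    then have "coprime i j"
      using assms(2) by (intro primes_coprime) auto
    \<comment> \<open>Passing to squares treats the modulus 4 and the prime moduli alike, since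
      \<open>m i\<close> always divides \<open>i ^ 2\<close>.\<close>
    then have "coprime (i ^ 2) (j ^ 2)" by simp
    moreover have "m i dvd i ^ 2" "m j dvd j ^ 2"
      by (auto simp: m_def)
    ultimately show "coprime (m i) (m j)"
      by (meson coprime_divisors)
  qed
  obtain x where x: "\<forall>i\<in>insert 2 P. [x = a i] (mod m i)"
    using chinese_remainder_nat[OF _ cop] assms(1) by blast
  have "2 \<notin> P"
    using assms(2) by blast
  then have M: "(\<Prod>i\<in>insert 2 P. m i) = 4 * \<Prod>P"
    using assms(1) by (simp add: m_def) (intro prod.cong; auto)
  let ?M = "4 * \<Prod>P"
  let ?n = "x mod ?M"
  have n: "[?n = a i] (mod m i)" if "i \<in> insert 2 P" for i
  proof -
    have "m i dvd ?M"
      unfolding M[symmetric] using that assms(1) by (intro dvd_prodI) auto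
    then have "[?n = x] (mod m i)"
      by (simp add: cong_def mod_mod_cancel)
    then show ?thesis
      using x that cong_trans by blast
  qed
  have "\<not> [y\<^sup>2 = ?n] (mod p)" if "p \<in> P" for p y
  proof -
    have "m p = p"
      using that \<open>2 \<notin> P\<close> by (auto simp: m_def)
    then have "[?n = a p] (mod p)"
      using n[of p] that by simp
    then show ?thesis
      using a[OF that] cong_trans by blast
  qed
  moreover have "[?n = 2] (mod 4)"
    using n[of 2] by (simp add: a_def m_def)
  moreover have "?n < ?M"
    using assms(2) by (intro mod_less_divisor mult_pos_pos prod_pos) (auto intro: prime_gt_0_nat)
  ultimately show ?thesis by blast
qed

text \<open>With \<open>card P + 2\<close> distinct prime factors, all at least \<open>N\<close>,
  \<open>m\<close> would be at least \<open>N ^ (card P + 2)\<close>. But \<open>\<Prod>P\<close> is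
  at most \<open>N ^ card P\<close>, and the remaining factor \<open>4 * (N + 1)\<close> is at most
  \<open>N ^ 2\<close>.\<close>

lemma card_large_prime_factors_le:
  fixes P :: "nat set"
  assumes "finite P" "\<And>p. p \<in> P \<Longrightarrow> p < N" "N \<ge> 6" "m > 0" "m < 4 * \<Prod>P * (N + 1)"
    and "\<And>q. q \<in> prime_factors m \<Longrightarrow> N \<le> q"
  shows "card (prime_factors m) \<le> card P + 1"
proof (rule ccontr)
  let ?Q = "prime_factors m"
  assume "\<not> ?thesis"
  then have "N ^ (card P + 2) \<le> N ^ card ?Q"
    using assms(3) by (intro power_increasing) auto
  also have "\<dots> = (\<Prod>q\<in>?Q. N)" by simp
  also have "\<dots> \<le> \<Prod>?Q"
    using assms(6) by (intro prod_mono) auto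
  also have "\<dots> \<le> (\<Prod>q\<in>?Q. q ^ multiplicity q m)"
    by (intro prod_mono) (auto intro!: self_le_power prime_gt_0_nat simp: prime_factors_multiplicity Suc_le_eq)
  also have "\<dots> = m"
    using prod_prime_factors[of m] assms(4) by simp
  also have "\<dots> < 4 * \<Prod>P * (N + 1)" by fact
  also have "\<dots> \<le> 4 * N ^ card P * (N + 1)"
  proof -
    have "\<Prod>P \<le> (\<Prod>p\<in>P. N)"
      using assms(2) by (intro prod_mono) (auto intro: less_imp_le)
    then show ?thesis
      by (intro mult_right_mono mult_left_mono) auto
  qed
  also have "\<dots> \<le> N ^ card P * N ^ 2"
  proof -
    have "4 * (N + 1) \<le> 6 * N"
      using assms(3) by simp
    also have "\<dots> \<le> N ^ 2"
      unfolding power2_eq_square using assms(3) by (intro mult_right_mono) auto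
    finally have "4 * (N + 1) \<le> N ^ 2" .
    from mult_left_mono[OF this, of "N ^ card P"] show ?thesis
      by (simp add: algebra_simps)
  qed
  finally show False
    by (simp add: power_add power2_eq_square)
qed

section \<open>Construction of arbitrarily large exceptions\<close>

theorem theorem4p17:
  shows "infinite {n :: nat. \<not> (\<exists>(z :: nat) (x :: nat). zumkeller z \<and> x > 0 \<and> n = z + x\<^sup>2)}"
  unfolding infinite_nat_iff_unbounded_le
proof
  fix t :: nat
  define T where "T = t + 1"
  define N where "N = 210 * T"
  define P where "P = {p. prime p \<and> p \<noteq> 2 \<and> p < N}"
  define M where "M = 4 * \<Prod>P"
  have finP: "finite P"
    unfolding P_def by simp
  have cardP: "card P \<le> 48 * T + 3"
    unfolding P_def N_def by (rule card_primes_below_multiple_of_210)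
  have M: "M > 0"
    unfolding M_def P_def by (auto intro!: prod_pos prime_gt_0_nat)
  obtain k where k: "k < M" "[k = 2] (mod 4)" "\<And>p x. p \<in> P \<Longrightarrow> \<not> [x\<^sup>2 = k] (mod p)"
    using ex_nonresidue_mod_primes[OF finP] unfolding M_def P_def by blast
  \<comment> \<open>Adding \<open>M * N\<close> keeps all congruences of \<open>k\<close> and forces
    \<open>n \<ge> t\<close>, while \<open>n < M * (N + 1)\<close> remains true.\<close>
  define n where "n = k + M * N"
  have n4: "n mod 4 = 2"
    using k(2) by (simp add: n_def M_def cong_def mult.assoc)
  have nonres: "\<not> [x\<^sup>2 = n] (mod p)" if "p \<in> P" for p x
  proof -
    have "p dvd M * N"
      using that finP unfolding M_def by (intro dvd_mult2 dvd_mult dvd_prodI[of P p "\<lambda>x. x", simplified])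
    then have "[n = k] (mod p)"
      by (auto simp: n_def cong_def elim!: dvdE)
    then show ?thesis
      using k(3)[OF that] cong_trans by blast
  qed
  have "\<not> zumkeller z" if z: "n = z + x\<^sup>2" for z x
  proof
    assume zum: "zumkeller z"
    then have z0: "z > 0"
      by (simp add: zumkeller_def)
    \<comment> \<open>Otherwise \<open>x\<^sup>2\<close> would be 2 modulo 4, which no square is. So
      \<open>z\<close> is odd or twice an odd number.\<close>
    have "\<not> 4 dvd z"
    proof
      assume "4 dvd z"
      then have "x\<^sup>2 mod 4 = 2"
        using n4 z by (auto elim!: dvdE)
      moreover have "x mod 4 = 0 \<or> x mod 4 = 1 \<or> x mod 4 = 2 \<or> x mod 4 = 3"
        by presburger
      ultimately show False
        using power_mod[of x 4 2]
        by auto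
    qed
    then obtain c m where m: "z = c * m" "odd m" "c = 1 \<or> c = 2"
    proof (cases "even z")
      case True
      then obtain m where "z = 2 * m" by blast
      then show ?thesis using that[of 2 m] \<open>\<not> 4 dvd z\<close> by auto
    qed (use that[of 1 z] in auto)
    have m0: "m > 0"
      using m(2) by (cases m) auto
    \<comment> \<open>A smaller prime factor \<open>q\<close> of the odd number \<open>m\<close>
      would lie in \<open>P\<close>, and \<open>q dvd z\<close> would make \<open>n\<close>
      congruent to \<open>x\<^sup>2\<close> modulo \<open>q\<close>.\<close>
    have large: "N \<le> q" if "q \<in> prime_factors m" for q
    proof (rule ccontr)
      assume "\<not> N \<le> q"
      then have "q \<in> P"
        using that m(2) unfolding P_def by (auto simp: in_prime_factors_iff)
      moreover have "q dvd z"
        using that m(1) by (auto simp: in_prime_factors_iff)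
      then have "[x\<^sup>2 = n] (mod q)"
        by (auto simp: z cong_def elim!: dvdE)
      ultimately show False
        using nonres by blast
    qed
    have "m \<le> z"
      using m by auto
    also have "z \<le> n"
      using z by simp
    also have "n < 4 * \<Prod>P * (N + 1)"
      using k(1) by (simp add: n_def M_def)
    finally have "card (prime_factors m) \<le> card P + 1"
      using m0 large finP by (intro card_large_prime_factors_le[of P N]) (auto simp: P_def N_def T_def)
    \<comment> \<open>Here \<open>4 * (48 * T + 4) = 192 * T + 16\<close> is less than
      \<open>210 * T\<close> because \<open>T\<close> is at least 1.\<close>
    then have "4 * card (prime_factors m) < N"
      using cardP by (simp add: N_def T_def)
    then have dm: "3 * divisor_sum m < 4 * m"
      using divisor_sum_few_large_primes[OF m0 large] by blast
    have "divisor_sum z \<le> divisor_sum c * divisor_sum m"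
      unfolding m(1) using m(3) m0 by (intro divisor_sum_mult_le) auto
    moreover have "divisor_sum 1 = 1"
      by (simp add: divisor_sum_def)
    moreover have "divisor_sum 2 = 3"
    proof -
      have "{d. d dvd (2::nat)} = {1, 2}"
        using two_is_prime_nat by (auto simp: prime_nat_iff)
      then show ?thesis by (simp add: divisor_sum_def)
    qed
    ultimately have "divisor_sum z < 2 * z"
      using m dm by auto
    then show False
      using zumkeller_imp_not_deficient[OF zum] by simp
  qed
  moreover have "t \<le> n"
  proof -
    have "t \<le> N" by (simp add: N_def T_def)
    also have "N \<le> M * N" using M by simp
    finally show ?thesis by (simp add: n_def)
  qed
  ultimately show "\<exists>n\<ge>t. n \<in> {n. \<not> (\<exists>z x. zumkeller z \<and> x > 0 \<and> n = z + x\<^sup>2)}"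
    by blast
qed

end
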